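(* Let $D$ be a domain in $\mathbb{R}^n$ and let $U$ be a neighborhood of $\partial D$ such that, whenever $D\cap U$ contains two sides of a triangle, it ($D\cap U$) also contains the midpoint of the third side of that triangle. Then $D$ is convex.
   Context: A domain is a connected open set. The sides of a triangle with vertices $x,y,z\in\mathbb{R}^n$ are the closed line segments $[x,y]$, $[y,z]$, $[z,x]$. *)

theory Defs
  imports "HOL-Analysis.Analysis"
begin

end

theory Submission
  imports Defs
begin

text \<open>
  It suffices to show that two sides \<open>[x,y]\<close>, \<open>[y,z]\<close> in \<open>D\<close> force the third side into \<open>D\<close>:
  then ``\<open>[a,b] \<subseteq> D\<close>'' is an equivalence relation on \<open>D\<close> that is locally trivial, hence trivial by
  connectedness. Otherwise blow the triangle up from \<open>y\<close>; the segment parallel to \<open>[x,z]\<close> meets the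
  complement of \<open>D\<close> a first time, and on that segment there is a first bad point \<open>q\<close>, which
  lies on the frontier. Take points \<open>a\<close> (before \<open>q\<close>, hence good) and \<open>b\<close> on the segment, symmetric about
  \<open>q\<close> and close to it, and contract both slightly towards \<open>y\<close>, to \<open>c\<close> and \<open>b'\<close>. The segment \<open>[c,b']\<close> lies
  in \<open>D\<close> by minimality, and the reflection of \<open>b'\<close> in \<open>q\<close> is so close to \<open>a\<close> that it can be joined to \<open>c\<close>
  inside \<open>D\<close>. So \<open>q\<close> is the midpoint of the third side of a triangle that puts it into \<open>D\<close>.
\<close>

lemma third_side_if_midpoints_near_frontier:
  fixes D U :: "'a::real_normed_vector set"
  assumes "open D"
    and nbhd: "frontier D \<subseteq> interior U"
    and triangle: "\<And>x y z. closed_segment x y \<subseteq> D \<inter> U \<Longrightarrow> closed_segment y z \<subseteq> D \<inter> U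
                     \<Longrightarrow> midpoint x z \<in> D \<inter> U"
    and xy: "closed_segment x y \<subseteq> D" and yz: "closed_segment y z \<subseteq> D"
  shows "closed_segment x z \<subseteq> D"
proof (rule ccontr)
  assume bad: "\<not> closed_segment x z \<subseteq> D"
  \<comment> \<open>For \<open>l\<close> from 0 to 1, \<open>f t l\<close> runs along the side
    opposite \<open>y\<close> of the triangle scaled by \<open>t\<close> about \<open>y\<close>; its
    ends lie on the two given sides.\<close>
  define f where "f = (\<lambda>t l. y + t *\<^sub>R ((1 - l) *\<^sub>R (x - y) + l *\<^sub>R (z - y)))"
  have f_left: "f t 0 \<in> D" if "0 \<le> t" "t \<le> 1" for t
  proof -
    have "f t 0 = (1 - t) *\<^sub>R y + t *\<^sub>R x" by (simp add: f_def algebra_simps)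
    then have "f t 0 \<in> closed_segment y x" using that by (auto simp: closed_segment_def)
    then show ?thesis using xy by (auto simp: closed_segment_commute)
  qed
  have f_right: "f t 1 \<in> D" if "0 \<le> t" "t \<le> 1" for t
  proof -
    have "f t 1 = (1 - t) *\<^sub>R y + t *\<^sub>R z" by (simp add: f_def algebra_simps)
    then have "f t 1 \<in> closed_segment y z" using that by (auto simp: closed_segment_def)
    then show ?thesis using yz by auto
  qed
  \<comment> \<open>Compactness of the set of bad parameters yields a least scale \<open>t\<close>
    with a bad point.\<close>
  define K where "K = ({0..1} \<times> {0..1}) \<inter> (\<lambda>p. f (fst p) (snd p)) -` (- D)"
  have "compact K"
    unfolding K_def f_def
    by (intro compact_Int_closed compact_Times compact_Icc closed_vimage continuous_intros
        closed_Compl \<open>open D\<close>)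
  moreover have "f 1 l = (1 - l) *\<^sub>R x + l *\<^sub>R z" for l
    by (simp add: f_def algebra_simps)
  with bad obtain l where "0 \<le> l" "l \<le> 1" "f 1 l \<notin> D"
    unfolding closed_segment_def by auto
  then have "(1, l) \<in> K" by (simp add: K_def)
  ultimately obtain p where p: "p \<in> K" and p_min: "\<And>p'. p' \<in> K \<Longrightarrow> fst p \<le> fst p'"
    using continuous_attains_inf[of K fst] continuous_on_fst[OF continuous_on_id]
    by (metis empty_iff)
  define t where "t = fst p"
  have t: "0 \<le> t" "t \<le> 1" using p by (auto simp: K_def t_def)
  have below: "f s l \<in> D" if "0 \<le> s" "s < t" "0 \<le> l" "l \<le> 1" for s l
    using p_min[of "(s, l)"] that t by (force simp: K_def t_def)
  define L where "L = {0..1} \<inter> f t -` (- D)"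
  have "compact L"
    unfolding L_def f_def
    by (intro compact_Int_closed compact_Icc closed_vimage continuous_intros closed_Compl \<open>open D\<close>)
  moreover have "snd p \<in> L" using p by (auto simp: K_def L_def t_def)
  ultimately obtain m where m: "m \<in> L" and m_min: "\<And>l. l \<in> L \<Longrightarrow> m \<le> l"
    using compact_attains_inf[of L] by (metis empty_iff)
  define q where "q = f t m"
  have "q \<notin> D" using m by (simp add: L_def q_def)
  have before: "f t l \<in> D" if "0 \<le> l" "l < m" for l
    using m_min[of l] that m by (force simp: L_def)
  have "m \<noteq> 0" "m \<noteq> 1"
    using f_left[OF t] f_right[OF t] m by (auto simp: L_def)
  then have m01: "0 < m" "m < 1" using m by (auto simp: L_def)
  \<comment> \<open>At scale 0 everything collapses to \<open>y\<close>, which lies in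
    \<open>D\<close>.\<close>
  have "t \<noteq> 0"
    using \<open>q \<notin> D\<close> yz by (auto simp: q_def f_def)
  then have "0 < t" using t by simp
  have lim_m: "((\<lambda>d. f t (m - d)) \<longlongrightarrow> q) (at_right 0)" "((\<lambda>d. f t (m + d)) \<longlongrightarrow> q) (at_right 0)"
    unfolding f_def q_def by (auto intro!: tendsto_eq_intros)
  have ev_m: "eventually (\<lambda>d. 0 < d \<and> d < m \<and> d < 1 - m) (at_right 0)"
    using m01 eventually_at_right_real[of 0 "min m (1 - m)"] by (auto elim: eventually_mono)
  \<comment> \<open>\<open>q\<close> is a limit of the good points before it.\<close>
  have "q \<in> closure D"
  proof (rule Lim_in_closed_set[OF closed_closure _ _ lim_m(1)])
    show "\<forall>\<^sub>F d in at_right 0. f t (m - d) \<in> closure D"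
      using ev_m by eventually_elim (auto intro!: before closure_subset[THEN subsetD])
  qed simp
  then have "q \<in> interior U"
    using nbhd \<open>q \<notin> D\<close> \<open>open D\<close> by (auto simp: frontier_def interior_open)
  then obtain r where "0 < r" and ball_U: "ball q r \<subseteq> U" by (auto simp: mem_interior)
  have "\<forall>\<^sub>F d in at_right 0. f t (m - d) \<in> ball q r \<and> f t (m + d) \<in> ball q r
          \<and> 0 < d \<and> d < m \<and> d < 1 - m"
    using lim_m[THEN topological_tendstoD, of "ball q r"] \<open>0 < r\<close> ev_m
    by (auto intro!: eventually_conj)
  then obtain d where d: "f t (m - d) \<in> ball q r" "f t (m + d) \<in> ball q r"
      "0 < d" "d < m" "d < 1 - m"
    using eventually_happens'[OF trivial_limit_at_right_real] by blast
  define a where "a = f t (m - d)"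
  have "a \<in> D \<inter> ball q r" using before d by (auto simp: a_def)
  moreover have "open (D \<inter> ball q r)" using \<open>open D\<close> by auto
  \<comment> \<open>This convex ball will hold both \<open>c e\<close> and the reflection of
    \<open>b' e\<close> in \<open>q\<close>.\<close>
  ultimately obtain \<rho> where "0 < \<rho>" and ball_a: "ball a \<rho> \<subseteq> D \<inter> ball q r"
    using openE by blast
  \<comment> \<open>The point \<open>f t (m + d)\<close> beyond \<open>q\<close> may be bad; the
    factor \<open>1 - e\<close> leads to a scale below \<open>t\<close>, where \<open>below\<close>
    applies.\<close>
  define b' where "b' = (\<lambda>e. f ((1 - e) * t) (m + d))"
  define c where "c = (\<lambda>e. f ((1 - e) * t) (m - d))"
  have lim_b': "(b' \<longlongrightarrow> f t (m + d)) (at_right 0)" and lim_c: "(c \<longlongrightarrow> a) (at_right 0)"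
    unfolding b'_def c_def a_def f_def by (auto intro!: tendsto_eq_intros)
  \<comment> \<open>As \<open>f t\<close> is affine, the reflection of \<open>f t (m + d)\<close> in
    \<open>q\<close> is exactly \<open>a\<close>; a small contraction moves it only
    slightly.\<close>
  have lim_refl: "((\<lambda>e. 2 *\<^sub>R q - b' e) \<longlongrightarrow> a) (at_right 0)"
  proof -
    have f_affine: "f t l = f t 0 + (t * l) *\<^sub>R (z - x)" for l
      by (simp add: f_def algebra_simps)
    have "2 *\<^sub>R q - f t (m + d) = a"
      unfolding q_def a_def f_affine[of m] f_affine[of "m + d"] f_affine[of "m - d"] scaleR_2
      by (simp add: algebra_simps)
    with tendsto_diff[OF tendsto_const[of "2 *\<^sub>R q"] lim_b'] show ?thesis by simp
  qed
  have "\<forall>\<^sub>F e in at_right 0. b' e \<in> ball q r \<and> c e \<in> ball a \<rho>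
      \<and> 2 *\<^sub>R q - b' e \<in> ball a \<rho> \<and> e \<in> {0<..<1}"
    using d(2) \<open>0 < \<rho>\<close>
    by (intro eventually_conj eventually_at_right_real topological_tendstoD[OF lim_b']
        topological_tendstoD[OF lim_c] topological_tendstoD[OF lim_refl]) auto
  from eventually_happens'[OF trivial_limit_at_right_real this]
  obtain e where e: "b' e \<in> ball q r" "c e \<in> ball a \<rho>" "2 *\<^sub>R q - b' e \<in> ball a \<rho>"
      "0 < e" "e < 1"
    unfolding greaterThanLessThan_iff by blast
  have "closed_segment (2 *\<^sub>R q - b' e) (c e) \<subseteq> ball a \<rho>"
    using e by (intro closed_segment_subset) auto
  then have side1: "closed_segment (2 *\<^sub>R q - b' e) (c e) \<subseteq> D \<inter> U"
    using ball_a ball_U by blast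
  have "closed_segment (c e) (b' e) \<subseteq> ball q r"
    using e ball_a by (intro closed_segment_subset) auto
  moreover have "closed_segment (c e) (b' e) \<subseteq> D"
  proof
    fix w assume "w \<in> closed_segment (c e) (b' e)"
    then obtain k where k: "0 \<le> k" "k \<le> 1" "w = (1 - k) *\<^sub>R c e + k *\<^sub>R b' e"
      by (auto simp: closed_segment_def)
    \<comment> \<open>At a fixed scale \<open>f\<close> is affine in its second argument, so
      \<open>w\<close> stays at scale \<open>(1 - e) * t\<close>.\<close>
    have f_combine: "(1 - k) *\<^sub>R f s l + k *\<^sub>R f s l' = f s ((1 - k) * l + k * l')" for s l l'
      by (simp add: f_def algebra_simps)
    define l where "l = (1 - k) * (m - d) + k * (m + d)"
    have "w = f ((1 - e) * t) l"
      by (simp only: k(3) c_def b'_def l_def f_combine)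
    moreover have "0 \<le> (1 - e) * t" "(1 - e) * t < t"
      using e \<open>0 < t\<close> by auto
    moreover have "0 \<le> l" "l \<le> 1"
    proof -
      have "l = m - d + k * (2 * d)" by (simp add: l_def algebra_simps)
      moreover have "k * (2 * d) \<le> 2 * d" "0 \<le> k * (2 * d)"
        using k d by (auto intro: mult_left_le_one_le)
      ultimately show "0 \<le> l" "l \<le> 1" using d by linarith+
    qed
    ultimately show "w \<in> D" by (simp add: below)
  qed
  ultimately have side2: "closed_segment (c e) (b' e) \<subseteq> D \<inter> U"
    using ball_U by blast
  have "midpoint (2 *\<^sub>R q - b' e) (b' e) = q"
    by (simp add: midpoint_def)
  then show False
    using triangle[OF side1 side2] \<open>q \<notin> D\<close> by simp
qed

lemma convex_if_third_sides:
  fixes D :: "'a::real_normed_vector set"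
  assumes "open D" "connected D"
    and third: "\<And>x y z. closed_segment x y \<subseteq> D \<Longrightarrow> closed_segment y z \<subseteq> D
                  \<Longrightarrow> closed_segment x z \<subseteq> D"
  shows "convex D"
  unfolding convex_contains_segment
proof (intro ballI)
  fix a b assume "a \<in> D" "b \<in> D"
  show "closed_segment a b \<subseteq> D"
  proof (rule connected_equivalence_relation[OF \<open>connected D\<close> \<open>a \<in> D\<close> \<open>b \<in> D\<close>,
        where R = "\<lambda>x y. closed_segment x y \<subseteq> D"])
    fix x assume "x \<in> D"
    then obtain r where "0 < r" and r: "ball x r \<subseteq> D"
      using \<open>open D\<close> openE by blast
    \<comment> \<open>Balls are convex, which makes the relation locally trivial.\<close>
    have "closed_segment x y \<subseteq> D" if "y \<in> ball x r" for y
      using closed_segment_subset[of x "ball x r" y] that \<open>0 < r\<close> r by auto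
    moreover have "openin (top_of_set D) (ball x r)"
      using r \<open>open D\<close> by (simp add: openin_open_eq)
    ultimately show "\<exists>T. openin (top_of_set D) T \<and> x \<in> T \<and> (\<forall>y\<in>T. closed_segment x y \<subseteq> D)"
      using \<open>0 < r\<close> by (metis centre_in_ball)
  qed (use third in \<open>auto simp: closed_segment_commute\<close>)
qed

theorem proposition2:
  fixes D U :: "(real ^ 'n) set"
  assumes domain: "open D" "connected D"
    and nbhd: "frontier D \<subseteq> interior U"
    and triangle: "\<And>x y z. closed_segment x y \<subseteq> D \<inter> U \<Longrightarrow> closed_segment y z \<subseteq> D \<inter> U
                     \<Longrightarrow> midpoint x z \<in> D \<inter> U"
  shows "convex D"
proof (rule convex_if_third_sides[OF domain])
  fix x y z assume "closed_segment x y \<subseteq> D" "closed_segment y z \<subseteq> D"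
  with triangle show "closed_segment x z \<subseteq> D"
    by (intro third_side_if_midpoints_near_frontier[OF \<open>open D\<close> nbhd, of x y z]) blast+
qed

end
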